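(* Let $I\subseteq\mathbb{R}$ be an interval and let $h:(0,1)\to(0,\infty)$ be a function such that $h(1-\lambda)+h(\lambda)\geq1$ for all $\lambda\in(0,1)$. Let $h$ be concave and let $(f,g)$ be an $h$-Jensen pair of positive functions $f,g:I\to\mathbb{R}$. Then $$\max\{h(1/2),\,2h(1/4)\}\,\big(g(x)+g(y)+g(z)\big)+2h(3/4)\,g\left(\frac{x+y+z}{3}\right)\ \geq\ f\left(\frac{x+y}{2}\right)+f\left(\frac{y+z}{2}\right)+f\left(\frac{z+x}{2}\right)$$ for all $x,y,z\in I$.
   Context: A pair $(f,g)$ of functions $f,g:I\to\mathbb{R}$ is called an $h$-Jensen pair if $f((1-\lambda)x+\lambda y)\leq h(1-\lambda)g(x)+h(\lambda)g(y)$ for all $x,y\in I$ and all $\lambda\in(0,1)$. *)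

theory Defs
  imports "HOL-Analysis.Analysis"
begin

text \<open>Functions on \<open>I\<close> and on \<open>(0,1)\<close> are total functions on the reals of which only
  the values on \<open>I\<close>, respectively on \<open>(0,1)\<close>, are used.\<close>

definition h_Jensen_pair ::
  "(real \<Rightarrow> real) \<Rightarrow> real set \<Rightarrow> (real \<Rightarrow> real) \<Rightarrow> (real \<Rightarrow> real) \<Rightarrow> bool" where
  "h_Jensen_pair h I f g \<longleftrightarrow>
     (\<forall>x\<in>I. \<forall>y\<in>I. \<forall>l\<in>{0<..<1}.
        f ((1 - l) * x + l * y) \<le> h (1 - l) * g x + h l * g y)"

end

theory Submission imports Defs begin

text \<open>As in the classical proof of Popoviciu's inequality, let \<open>m\<close> be the mean of \<open>x, y, z\<close>.
  If \<open>x\<close> and \<open>y\<close> lie strictly on the same side of \<open>m\<close>, then \<open>(x + z) / 2\<close> and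
  \<open>(y + z) / 2\<close> are convex combinations of \<open>m\<close> and \<open>z\<close> whose weights at \<open>m\<close> add up to
  \<open>3/2\<close>, so concavity bounds the sums of the \<open>h\<close>-values by \<open>2 h(3/4)\<close> and \<open>2 h(1/4)\<close>.
  The pair inequality is not available with weights \<open>0, 1\<close>, so the case where one of the points
  equals \<open>m\<close> needs a limit: there \<open>f m \<le> (h e + h (1 - e)) g m\<close> with \<open>e\<close> tending to \<open>0\<close>.\<close>

lemma concave_on_midpoint:
  fixes h :: "real \<Rightarrow> real"
  assumes "concave_on S h" "p \<in> S" "q \<in> S" "p + q = 2 * c"
  shows "h p + h q \<le> 2 * h c"
proof -
  have "h ((1 - 1/2) *\<^sub>R p + (1/2) *\<^sub>R q) \<ge> (1 - 1/2) * h p + (1/2) * h q"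
    by (rule concave_onD[OF assms(1)]) (use assms in auto)
  moreover have "(1 - 1/2) *\<^sub>R p + (1/2) *\<^sub>R q = c"
    using assms(4) by simp
  ultimately show ?thesis by (simp only:) simp
qed

lemma h_Jensen_pairD:
  assumes "h_Jensen_pair h I f g" "x \<in> I" "y \<in> I" "0 < l" "l < 1"
    and "w = (1 - l) * x + l * y"
  shows "f w \<le> h (1 - l) * g x + h l * g y"
  using assms unfolding h_Jensen_pair_def by auto

lemma h_Jensen_pair_midpoint:
  assumes "h_Jensen_pair h I f g" "x \<in> I" "y \<in> I"
  shows "f ((x + y) / 2) \<le> h (1/2) * (g x + g y)"
  using h_Jensen_pairD[OF assms, of "1/2" "(x + y) / 2"] by (simp add: field_simps)

lemma Popoviciu_same_side:
  fixes h f g :: "real \<Rightarrow> real"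
  assumes conc: "concave_on {0<..<1} h" and pair: "h_Jensen_pair h I f g"
    and gpos: "\<And>u. u \<in> I \<Longrightarrow> g u > 0"
    and I: "x \<in> I" "y \<in> I" "z \<in> I" "m \<in> I"
    and m: "x + y + z = 3 * m" and side: "(m - x) * (m - y) > 0"
  shows "f ((x + y) / 2) + f ((y + z) / 2) + f ((z + x) / 2)
    \<le> max (h (1/2)) (2 * h (1/4)) * (g x + g y + g z) + 2 * h (3/4) * g m"
proof -
  define a b K where "a = m - x" and "b = m - y" and "K = max (h (1/2)) (2 * h (1/4))"
  \<comment> \<open>Since z - m = a + b and (z + x) / 2 - m = b / 2, solving (z + x) / 2 = (1 - s) *
    z + s * m gives \<open>s\<close>; swapping \<open>a\<close> and \<open>b\<close> gives
    \<open>t\<close>. Equal signs of \<open>a\<close> and \<open>b\<close> put both weights strictly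
    between 0 and 1.\<close>
  define s t where "s = (a + b / 2) / (a + b)" and "t = (a / 2 + b) / (a + b)"
  have ab: "(0 < a \<and> 0 < b) \<or> (a < 0 \<and> b < 0)"
    using side by (auto simp: a_def b_def zero_less_mult_iff)
  then have st: "0 < s" "s < 1" "0 < t" "t < 1"
    by (auto simp: s_def t_def field_simps)
  have sum: "s + t = 3/2"
    using ab by (auto simp: s_def t_def add_divide_distrib[symmetric] field_simps)
  have z: "z = m + a + b" "x = m - a" "y = m - b"
    using m by (auto simp: a_def b_def)
  have "s * (a + b) = a + b / 2" "t * (a + b) = a / 2 + b"
    using ab by (auto simp: s_def t_def)
  then have eqs: "(z + x) / 2 = (1 - s) * z + s * m" "(y + z) / 2 = (1 - t) * z + t * m"
    by (auto simp: z algebra_simps)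
  have fs: "f ((z + x) / 2) \<le> h (1 - s) * g z + h s * g m"
    by (rule h_Jensen_pairD[OF pair]) (use I st eqs in auto)
  have ft: "f ((y + z) / 2) \<le> h (1 - t) * g z + h t * g m"
    by (rule h_Jensen_pairD[OF pair]) (use I st eqs in auto)
  have "h s + h t \<le> 2 * h (3/4)" "h (1 - s) + h (1 - t) \<le> 2 * h (1/4)"
    by (rule concave_on_midpoint[OF conc]; use st sum in simp)+
  then have "(h s + h t) * g m \<le> 2 * h (3/4) * g m" "(h (1 - s) + h (1 - t)) * g z \<le> K * g z"
    using gpos I by (auto intro!: mult_right_mono less_imp_le simp: K_def)
  \<comment> \<open>The second entry of the maximum \<open>K\<close> was used at \<open>g z\<close>;
    the first one absorbs the midpoint of \<open>x\<close> and \<open>y\<close>, bounded by the pair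
    inequality with weight 1/2.\<close>
  moreover have "h (1/2) * (g x + g y) \<le> K * (g x + g y)"
    using gpos I by (intro mult_right_mono) (auto simp: K_def add_nonneg_nonneg less_imp_le)
  ultimately show ?thesis
    using fs ft h_Jensen_pair_midpoint[OF pair I(1,2)]
    unfolding K_def[symmetric] by (simp add: algebra_simps)
qed

text \<open>Concavity trades h (1 - e) + h e for values near 1/2, an interior point where a concave
  function is continuous. So the limit never asks how \<open>h\<close> behaves at 0 or 1.\<close>

lemma h_Jensen_pair_diagonal:
  fixes h f g :: "real \<Rightarrow> real"
  assumes conc: "concave_on {0<..<1} h" and pair: "h_Jensen_pair h I f g"
    and "u \<in> I" "g u > 0"
  shows "f u \<le> (2 * h (1/4) + 2 * h (3/4) - 2 * h (1/2)) * g u"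
proof -
  have "continuous_on {0<..<1} (\<lambda>x. - h x)"
    using conc by (intro convex_on_continuous) (auto simp: concave_on_def)
  then have "continuous_on {0<..<1} h"
    using continuous_on_minus by fastforce
  then have "isCont h (1/2)"
    by (simp add: continuous_on_eq_continuous_at)
  moreover have "((\<lambda>e. 1/2 + e) \<longlongrightarrow> 1/2) (at_right (0::real))"
    "((\<lambda>e. 1/2 - e) \<longlongrightarrow> 1/2) (at_right (0::real))"
    by (auto intro!: tendsto_eq_intros)
  ultimately have lim: "((\<lambda>e. (2 * h (1/4) + 2 * h (3/4) - (h (1/2 + e) + h (1/2 - e))) * g u)
      \<longlongrightarrow> (2 * h (1/4) + 2 * h (3/4) - (h (1/2) + h (1/2))) * g u) (at_right 0)"
    by (intro tendsto_intros isCont_tendsto_compose[of _ h])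
  have "f u \<le> (2 * h (1/4) + 2 * h (3/4) - (h (1/2 + e) + h (1/2 - e))) * g u"
    if e: "0 < e" "e < 1/2" for e
  proof -
    \<comment> \<open>The two pairs have means 3/4 and 1/4, and e < 1/2 keeps all four arguments
      inside (0,1).\<close>
    have "h (1 - e) + h (1/2 + e) \<le> 2 * h (3/4)" "h e + h (1/2 - e) \<le> 2 * h (1/4)"
      by (rule concave_on_midpoint[OF conc]; use e in simp)+
    then have "(h (1 - e) + h e) * g u
        \<le> (2 * h (1/4) + 2 * h (3/4) - (h (1/2 + e) + h (1/2 - e))) * g u"
      using assms by (intro mult_right_mono) auto
    moreover have "f u \<le> h (1 - e) * g u + h e * g u"
      by (rule h_Jensen_pairD[OF pair]) (use assms e in \<open>auto simp: algebra_simps\<close>)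
    ultimately show ?thesis by (simp add: algebra_simps)
  qed
  then have "eventually (\<lambda>e. f u \<le> (2 * h (1/4) + 2 * h (3/4) - (h (1/2 + e) + h (1/2 - e))) * g u)
      (at_right 0)"
    by (auto simp: eventually_at_right_field intro!: exI[of _ "1/2"])
  from tendsto_lowerbound[OF lim this] show ?thesis by simp
qed

text \<open>The two midpoints involving \<open>m\<close> contribute 2 * h (1/2) * g m, which the
  negative term of the diagonal bound for \<open>f m\<close> cancels exactly.\<close>

lemma Popoviciu_at_mean:
  fixes h f g :: "real \<Rightarrow> real"
  assumes conc: "concave_on {0<..<1} h" and pair: "h_Jensen_pair h I f g"
    and gpos: "\<And>u. u \<in> I \<Longrightarrow> g u > 0"
    and I: "x \<in> I" "m \<in> I" "z \<in> I" and m: "x + z = 2 * m"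
  shows "f ((x + m) / 2) + f ((m + z) / 2) + f ((z + x) / 2)
    \<le> max (h (1/2)) (2 * h (1/4)) * (g x + g m + g z) + 2 * h (3/4) * g m"
proof -
  define K where "K = max (h (1/2)) (2 * h (1/4))"
  have "f m \<le> (2 * h (1/4) + 2 * h (3/4) - 2 * h (1/2)) * g m"
    by (rule h_Jensen_pair_diagonal[OF conc pair]) (use I gpos in auto)
  moreover have "(z + x) / 2 = m" using m by simp
  moreover have "h (1/2) * (g x + g z) \<le> K * (g x + g z)" "2 * h (1/4) * g m \<le> K * g m"
    using gpos I by (intro mult_right_mono; auto simp: K_def add_nonneg_nonneg less_imp_le)+
  ultimately show ?thesis
    using h_Jensen_pair_midpoint[OF pair I(1,2)] h_Jensen_pair_midpoint[OF pair I(2,3)]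
    unfolding K_def[symmetric] by (simp add: algebra_simps)
qed

theorem theorem5:
  fixes I :: "real set" and h f g :: "real \<Rightarrow> real"
  assumes "is_interval I"
    and "\<And>l. l \<in> {0<..<1} \<Longrightarrow> h l > 0"
    and "\<And>l. l \<in> {0<..<1} \<Longrightarrow> h (1 - l) + h l \<ge> 1"
    and "concave_on {0<..<1} h"
    and "\<And>x. x \<in> I \<Longrightarrow> f x > 0"
    and "\<And>x. x \<in> I \<Longrightarrow> g x > 0"
    and "h_Jensen_pair h I f g"
  shows "\<forall>x\<in>I. \<forall>y\<in>I. \<forall>z\<in>I.
    max (h (1/2)) (2 * h (1/4)) * (g x + g y + g z) + 2 * h (3/4) * g ((x + y + z) / 3)
      \<ge> f ((x + y) / 2) + f ((y + z) / 2) + f ((z + x) / 2)"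
proof (intro ballI)
  fix x y z assume I: "x \<in> I" "y \<in> I" "z \<in> I"
  define m where "m = (x + y + z) / 3"
  have m3: "x + y + z = 3 * m" by (simp add: m_def)
  have "min x (min y z) \<in> I" "max x (max y z) \<in> I"
    using I by (auto simp: min_def max_def)
  then have mI: "m \<in> I"
    by (rule mem_is_interval_1_I[OF assms(1)]) (auto simp: m_def min_def max_def)
  note same = Popoviciu_same_side[OF assms(4,7,6)]
  note mean = Popoviciu_at_mean[OF assms(4,7,6)]
  \<comment> \<open>Pigeonhole: of three nonzero deviations from \<open>m\<close>, two have the same
    sign. As the claim is symmetric, each case is a relabelling of one of the two lemmas.\<close>
  consider "m = x" | "m = y" | "m = z" | "(m - x) * (m - y) > 0" | "(m - y) * (m - z) > 0"
    | "(m - z) * (m - x) > 0"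
    unfolding zero_less_mult_iff by argo
  then have "max (h (1/2)) (2 * h (1/4)) * (g x + g y + g z) + 2 * h (3/4) * g m
      \<ge> f ((x + y) / 2) + f ((y + z) / 2) + f ((z + x) / 2)"
  proof cases
    case 1
    then show ?thesis using mean[of z m y] I m3 by (simp add: add_ac)
  next
    case 2
    then show ?thesis using mean[of x m z] I m3 by (simp add: add_ac)
  next
    case 3
    then show ?thesis using mean[of y m x] I m3 by (simp add: add_ac)
  next
    case 4
    then show ?thesis using same[of x y z m] I mI m3 by (simp add: add_ac)
  next
    case 5
    then show ?thesis using same[of y z x m] I mI m3 by (simp add: add_ac)
  next
    case 6
    then show ?thesis using same[of z x y m] I mI m3 by (simp add: add_ac)
  qed
  then show "max (h (1/2)) (2 * h (1/4)) * (g x + g y + g z) + 2 * h (3/4) * g ((x + y + z) / 3)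
      \<ge> f ((x + y) / 2) + f ((y + z) / 2) + f ((z + x) / 2)"
    by (simp only: m_def)
qed

end
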